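(* There is a one-to-one correspondence between strict Rota-Baxter $3$-Lie $2$-algebras of weight $\lambda$ and crossed modules of Rota-Baxter $3$-Lie algebras of weight $\lambda$.
   Context: Let $k$ be a field of characteristic $0$; vector spaces and tensor products are over $k$; $\lambda\in k$. A $3$-Lie algebra is a vector space $\mathfrak g$ with a linear map $[\cdot,\cdot,\cdot]:\wedge^3\mathfrak g\to\mathfrak g$ such that $[x_1,x_2,[x_3,x_4,x_5]]=[[x_1,x_2,x_3],x_4,x_5]+[x_3,[x_1,x_2,x_4],x_5]+[x_3,x_4,[x_1,x_2,x_5]]$. A representation on $M$ is a linear map $\rho:\wedge^2\mathfrak g\to\mathfrak{gl}(M)$ with $\rho(x_1,x_2)\rho(x_3,x_4)=\rho([x_1,x_2,x_3],x_4)+\rho(x_3,[x_1,x_2,x_4])+\rho(x_3,x_4)\rho(x_1,x_2)$ and $\rho(x_1,[x_2,x_3,x_4])=\rho(x_3,x_4)\rho(x_1,x_2)-\rho(x_2,x_4)\rho(x_1,x_3)+\rho(x_2,x_3)\rho(x_1,x_4)$. A Rota-Baxter $3$-Lie algebra of weight $\lambda$ is a $3$-Lie algebra with a linear map $T:\mathfrak g\to\mathfrak g$ such that $[T(x),T(y),T(z)]=T\big([T(x),T(y),z]+[T(x),y,T(z)]+[x,T(y),T(z)]+\lambda[T(x),y,z]+\lambda[x,T(y),z]+\lambda[x,y,T(z)]+\lambda^2[x,y,z]\big)$. A (Rota-Baxter) representation of it is a triple $(M,\rho,T_M)$ with $(M,\rho)$ a representation of the $3$-Lie algebra and $T_M\in\mathrm{End}(M)$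 satisfying $\rho(T(x),T(y))T_M(m)=T_M\big(\rho(T(x),T(y))m+\rho(T(x),y)T_M(m)+\rho(x,T(y))T_M(m)+\lambda\rho(T(x),y)m+\lambda\rho(x,T(y))m+\lambda\rho(x,y)T_M(m)+\lambda^2\rho(x,y)m\big)$. A strict Rota-Baxter $3$-Lie $2$-algebra of weight $\lambda$ (i.e. a Rota-Baxter $3$-Lie $2$-algebra whose structure maps $l_5$ and $T_2$ vanish) consists of vector spaces $\mathfrak g_0,\mathfrak g_1$, a linear map $d:\mathfrak g_1\to\mathfrak g_0$, completely skew-symmetric trilinear maps $l_3:\mathfrak g_i\otimes\mathfrak g_j\otimes\mathfrak g_k\to\mathfrak g_{i+j+k}$ ($0\le i+j+k\le1$), and linear maps $T_0:\mathfrak g_0\to\mathfrak g_0$, $T_1:\mathfrak g_1\to\mathfrak g_1$ such that for all $x,y,z\in\mathfrak g_0$, $\alpha,\beta\in\mathfrak g_1$: (1) $d\,l_3(x,y,\alpha)=l_3(x,y,d(\alpha))$; (2) $l_3(\alpha,d(\beta),x)=l_3(d(\alpha),\beta,x)$; (3) $l_3(a_1,a_2,l_3(a_3,a_4,a_5))=l_3(l_3(a_1,a_2,a_3),a_4,a_5)+l_3(a_3,l_3(a_1,a_2,a_4),a_5)+l_3(a_3,a_4,l_3(a_1,a_2,a_5))$ holds when all $a_i\in\mathfrak g_0$, when $a_1\in\mathfrak g_1$ and the other $a_i\in\mathfrak g_0$, and when $a_3\in\mathfrak g_1$ and the other $a_i\in\mathfrak g_0$; (4) $T_0\circ d=d\circ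 T_1$; (5) $T_0\big(l_3(T_0(x),T_0(y),z)+l_3(x,T_0(y),T_0(z))+l_3(T_0(x),y,T_0(z))+\lambda l_3(T_0(x),y,z)+\lambda l_3(x,T_0(y),z)+\lambda l_3(x,y,T_0(z))+\lambda^2l_3(x,y,z)\big)=l_3(T_0(x),T_0(y),T_0(z))$; (6) $T_1\big(l_3(T_0(x),T_0(y),\alpha)+l_3(x,T_0(y),T_1(\alpha))+l_3(T_0(x),y,T_1(\alpha))+\lambda l_3(T_0(x),y,\alpha)+\lambda l_3(x,T_0(y),\alpha)+\lambda l_3(x,y,T_1(\alpha))+\lambda^2l_3(x,y,\alpha)\big)=l_3(T_0(x),T_0(y),T_1(\alpha))$. A crossed module of Rota-Baxter $3$-Lie algebras of weight $\lambda$ is a sextuple $((\mathfrak g_0,[\cdot,\cdot,\cdot]_{\mathfrak g_0}),(\mathfrak g_1,[\cdot,\cdot,\cdot]_{\mathfrak g_1}),d,S,T_0,T_1)$ where $(\mathfrak g_0,[\cdot,\cdot,\cdot]_{\mathfrak g_0},T_0)$ is a Rota-Baxter $3$-Lie algebra of weight $\lambda$, $(\mathfrak g_1,[\cdot,\cdot,\cdot]_{\mathfrak g_1})$ is a $3$-Lie algebra, $d:\mathfrak g_1\to\mathfrak g_0$ is a homomorphism of $3$-Lie algebras, and $(\mathfrak g_1,S,T_1)$ is a representation of the Rota-Baxter $3$-Lie algebra $(\mathfrak g_0,[\cdot,\cdot,\cdot]_{\mathfrak g_0},T_0)$, such that for all $x,y\in\mathfrak g_0$, $\alpha,\beta,\gamma\in\mathfrak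 g_1$: $d(S(x,y)(\alpha))=[x,y,d(\alpha)]_{\mathfrak g_0}$, $T_0\circ d=d\circ T_1$, $S(d(\alpha),d(\beta))(\gamma)=[\alpha,\beta,\gamma]_{\mathfrak g_1}$, $S(x,d(\alpha))(\beta)=-S(x,d(\beta))(\alpha)$. *)

theory Defs
  imports Complex_Main
begin

text \<open>A vector space is given by a type of class \<open>ab_group_add\<close> together with a scalar
  multiplication satisfying \<^locale>\<open>vector_space\<close>. A linear map out of an exterior power is
  rendered as an alternating multilinear map.\<close>

definition trilinear ::
  "('k::field \<Rightarrow> 'a::ab_group_add \<Rightarrow> 'a) \<Rightarrow> ('k \<Rightarrow> 'b::ab_group_add \<Rightarrow> 'b) \<Rightarrow>
   ('k \<Rightarrow> 'c::ab_group_add \<Rightarrow> 'c) \<Rightarrow> ('k \<Rightarrow> 'd::ab_group_add \<Rightarrow> 'd) \<Rightarrow>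
   ('a \<Rightarrow> 'b \<Rightarrow> 'c \<Rightarrow> 'd) \<Rightarrow> bool" where
  "trilinear sa sb sc sd f \<longleftrightarrow>
     (\<forall>y z. Vector_Spaces.linear sa sd (\<lambda>x. f x y z)) \<and>
     (\<forall>x z. Vector_Spaces.linear sb sd (\<lambda>y. f x y z)) \<and>
     (\<forall>x y. Vector_Spaces.linear sc sd (\<lambda>z. f x y z))"

definition three_lie_algebra ::
  "('k::field \<Rightarrow> 'a::ab_group_add \<Rightarrow> 'a) \<Rightarrow> ('a \<Rightarrow> 'a \<Rightarrow> 'a \<Rightarrow> 'a) \<Rightarrow> bool" where
  "three_lie_algebra s br \<longleftrightarrow>
     trilinear s s s s br \<and>
     (\<forall>x y. br x x y = 0 \<and> br x y x = 0 \<and> br y x x = 0) \<and>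
     (\<forall>x1 x2 x3 x4 x5.
        br x1 x2 (br x3 x4 x5) =
          br (br x1 x2 x3) x4 x5 + br x3 (br x1 x2 x4) x5 + br x3 x4 (br x1 x2 x5))"

definition three_lie_hom ::
  "('k::field \<Rightarrow> 'a::ab_group_add \<Rightarrow> 'a) \<Rightarrow> ('a \<Rightarrow> 'a \<Rightarrow> 'a \<Rightarrow> 'a) \<Rightarrow>
   ('k \<Rightarrow> 'b::ab_group_add \<Rightarrow> 'b) \<Rightarrow> ('b \<Rightarrow> 'b \<Rightarrow> 'b \<Rightarrow> 'b) \<Rightarrow> ('a \<Rightarrow> 'b) \<Rightarrow> bool" where
  "three_lie_hom sa bra sb brb f \<longleftrightarrow>
     Vector_Spaces.linear sa sb f \<and>
     (\<forall>x y z. f (bra x y z) = brb (f x) (f y) (f z))"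

text \<open>\<open>\<rho> x y m\<close> stands for \<open>\<rho>(x, y)(m)\<close>; trilinearity says that \<open>\<rho>\<close> is bilinear with
  values in the linear endomorphisms of the module.\<close>

definition three_lie_rep ::
  "('k::field \<Rightarrow> 'a::ab_group_add \<Rightarrow> 'a) \<Rightarrow> ('a \<Rightarrow> 'a \<Rightarrow> 'a \<Rightarrow> 'a) \<Rightarrow>
   ('k \<Rightarrow> 'm::ab_group_add \<Rightarrow> 'm) \<Rightarrow> ('a \<Rightarrow> 'a \<Rightarrow> 'm \<Rightarrow> 'm) \<Rightarrow> bool" where
  "three_lie_rep s br sm \<rho> \<longleftrightarrow>
     trilinear s s sm sm \<rho> \<and>
     (\<forall>x m. \<rho> x x m = 0) \<and>
     (\<forall>x1 x2 x3 x4 m.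
        \<rho> x1 x2 (\<rho> x3 x4 m) =
          \<rho> (br x1 x2 x3) x4 m + \<rho> x3 (br x1 x2 x4) m + \<rho> x3 x4 (\<rho> x1 x2 m)) \<and>
     (\<forall>x1 x2 x3 x4 m.
        \<rho> x1 (br x2 x3 x4) m =
          \<rho> x3 x4 (\<rho> x1 x2 m) - \<rho> x2 x4 (\<rho> x1 x3 m) + \<rho> x2 x3 (\<rho> x1 x4 m))"

definition rb_three_lie_algebra ::
  "'k::field \<Rightarrow> ('k \<Rightarrow> 'a::ab_group_add \<Rightarrow> 'a) \<Rightarrow> ('a \<Rightarrow> 'a \<Rightarrow> 'a \<Rightarrow> 'a) \<Rightarrow> ('a \<Rightarrow> 'a) \<Rightarrow> bool" where
  "rb_three_lie_algebra w s br T \<longleftrightarrow>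
     three_lie_algebra s br \<and>
     Vector_Spaces.linear s s T \<and>
     (\<forall>x y z.
        br (T x) (T y) (T z) =
          T (br (T x) (T y) z + br (T x) y (T z) + br x (T y) (T z)
             + s w (br (T x) y z) + s w (br x (T y) z) + s w (br x y (T z))
             + s (w\<^sup>2) (br x y z)))"

definition rb_three_lie_rep ::
  "'k::field \<Rightarrow> ('k \<Rightarrow> 'a::ab_group_add \<Rightarrow> 'a) \<Rightarrow> ('a \<Rightarrow> 'a \<Rightarrow> 'a \<Rightarrow> 'a) \<Rightarrow> ('a \<Rightarrow> 'a) \<Rightarrow>
   ('k \<Rightarrow> 'm::ab_group_add \<Rightarrow> 'm) \<Rightarrow> ('a \<Rightarrow> 'a \<Rightarrow> 'm \<Rightarrow> 'm) \<Rightarrow> ('m \<Rightarrow> 'm) \<Rightarrow> bool" where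
  "rb_three_lie_rep w s br T sm \<rho> TM \<longleftrightarrow>
     three_lie_rep s br sm \<rho> \<and>
     Vector_Spaces.linear sm sm TM \<and>
     (\<forall>x y m.
        \<rho> (T x) (T y) (TM m) =
          TM (\<rho> (T x) (T y) m + \<rho> (T x) y (TM m) + \<rho> x (T y) (TM m)
              + sm w (\<rho> (T x) y m) + sm w (\<rho> x (T y) m) + sm w (\<rho> x y (TM m))
              + sm (w\<^sup>2) (\<rho> x y m)))"

text \<open>The map \<open>l\<^sub>3\<close> on \<open>\<gg>\<^sub>i \<otimes> \<gg>\<^sub>j \<otimes> \<gg>\<^sub>k\<close> is the field
  \<open>l_ijk\<close>; there is one field for each \<open>(i, j, k)\<close> with \<open>i + j + k \<le> 1\<close>.\<close>

record ('a, 'b) three_lie_2_data =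
  two_d :: "'b \<Rightarrow> 'a"
  l_000 :: "'a \<Rightarrow> 'a \<Rightarrow> 'a \<Rightarrow> 'a"
  l_001 :: "'a \<Rightarrow> 'a \<Rightarrow> 'b \<Rightarrow> 'b"
  l_010 :: "'a \<Rightarrow> 'b \<Rightarrow> 'a \<Rightarrow> 'b"
  l_100 :: "'b \<Rightarrow> 'a \<Rightarrow> 'a \<Rightarrow> 'b"
  two_T0 :: "'a \<Rightarrow> 'a"
  two_T1 :: "'b \<Rightarrow> 'b"

text \<open>Invariance up to sign under the transpositions (12) and (23), which generate the
  symmetric group. All signs are the ungraded ones, as at most one argument has degree 1.\<close>

definition l3_skew_symmetric :: "('a::ab_group_add, 'b::ab_group_add) three_lie_2_data \<Rightarrow> bool" where
  "l3_skew_symmetric A \<longleftrightarrow>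
     (\<forall>x y z. l_000 A y x z = - l_000 A x y z \<and> l_000 A x z y = - l_000 A x y z) \<and>
     (\<forall>x y \<alpha>. l_001 A y x \<alpha> = - l_001 A x y \<alpha> \<and> l_010 A x \<alpha> y = - l_001 A x y \<alpha>) \<and>
     (\<forall>x y \<alpha>. l_100 A \<alpha> x y = - l_010 A x \<alpha> y \<and> l_100 A \<alpha> y x = - l_100 A \<alpha> x y)"

definition strict_rb_three_lie_2_algebra ::
  "'k::field \<Rightarrow> ('k \<Rightarrow> 'a::ab_group_add \<Rightarrow> 'a) \<Rightarrow> ('k \<Rightarrow> 'b::ab_group_add \<Rightarrow> 'b) \<Rightarrow>
   ('a, 'b) three_lie_2_data \<Rightarrow> bool" where
  "strict_rb_three_lie_2_algebra w s0 s1 A \<longleftrightarrow>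
     (let d = two_d A; l000 = l_000 A; l001 = l_001 A; l010 = l_010 A; l100 = l_100 A;
          T0 = two_T0 A; T1 = two_T1 A
      in
        Vector_Spaces.linear s1 s0 d \<and>
        trilinear s0 s0 s0 s0 l000 \<and>
        trilinear s0 s0 s1 s1 l001 \<and>
        trilinear s0 s1 s0 s1 l010 \<and>
        trilinear s1 s0 s0 s1 l100 \<and>
        l3_skew_symmetric A \<and>
        Vector_Spaces.linear s0 s0 T0 \<and>
        Vector_Spaces.linear s1 s1 T1 \<and>
        (\<forall>x y \<alpha>. d (l001 x y \<alpha>) = l000 x y (d \<alpha>)) \<and>
        (\<forall>\<alpha> \<beta> x. l100 \<alpha> (d \<beta>) x = l010 (d \<alpha>) \<beta> x) \<and>
        (\<forall>a1 a2 a3 a4 a5.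
           l000 a1 a2 (l000 a3 a4 a5) =
             l000 (l000 a1 a2 a3) a4 a5 + l000 a3 (l000 a1 a2 a4) a5
             + l000 a3 a4 (l000 a1 a2 a5)) \<and>
        (\<forall>\<alpha>1 a2 a3 a4 a5.
           l100 \<alpha>1 a2 (l000 a3 a4 a5) =
             l100 (l100 \<alpha>1 a2 a3) a4 a5 + l010 a3 (l100 \<alpha>1 a2 a4) a5
             + l001 a3 a4 (l100 \<alpha>1 a2 a5)) \<and>
        (\<forall>a1 a2 \<alpha>3 a4 a5.
           l001 a1 a2 (l100 \<alpha>3 a4 a5) =
             l100 (l001 a1 a2 \<alpha>3) a4 a5 + l100 \<alpha>3 (l000 a1 a2 a4) a5
             + l100 \<alpha>3 a4 (l000 a1 a2 a5)) \<and>
        T0 \<circ> d = d \<circ> T1 \<and>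
        (\<forall>x y z.
           T0 (l000 (T0 x) (T0 y) z + l000 x (T0 y) (T0 z) + l000 (T0 x) y (T0 z)
               + s0 w (l000 (T0 x) y z) + s0 w (l000 x (T0 y) z) + s0 w (l000 x y (T0 z))
               + s0 (w\<^sup>2) (l000 x y z))
             = l000 (T0 x) (T0 y) (T0 z)) \<and>
        (\<forall>x y \<alpha>.
           T1 (l001 (T0 x) (T0 y) \<alpha> + l001 x (T0 y) (T1 \<alpha>) + l001 (T0 x) y (T1 \<alpha>)
               + s1 w (l001 (T0 x) y \<alpha>) + s1 w (l001 x (T0 y) \<alpha>) + s1 w (l001 x y (T1 \<alpha>))
               + s1 (w\<^sup>2) (l001 x y \<alpha>))
             = l001 (T0 x) (T0 y) (T1 \<alpha>)))"

record ('a, 'b) crossed_module_data =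
  cm_br0 :: "'a \<Rightarrow> 'a \<Rightarrow> 'a \<Rightarrow> 'a"
  cm_br1 :: "'b \<Rightarrow> 'b \<Rightarrow> 'b \<Rightarrow> 'b"
  cm_d :: "'b \<Rightarrow> 'a"
  cm_S :: "'a \<Rightarrow> 'a \<Rightarrow> 'b \<Rightarrow> 'b"
  cm_T0 :: "'a \<Rightarrow> 'a"
  cm_T1 :: "'b \<Rightarrow> 'b"

definition rb_three_lie_crossed_module ::
  "'k::field \<Rightarrow> ('k \<Rightarrow> 'a::ab_group_add \<Rightarrow> 'a) \<Rightarrow> ('k \<Rightarrow> 'b::ab_group_add \<Rightarrow> 'b) \<Rightarrow>
   ('a, 'b) crossed_module_data \<Rightarrow> bool" where
  "rb_three_lie_crossed_module w s0 s1 C \<longleftrightarrow>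
     (let br0 = cm_br0 C; br1 = cm_br1 C; d = cm_d C; S = cm_S C;
          T0 = cm_T0 C; T1 = cm_T1 C
      in
        rb_three_lie_algebra w s0 br0 T0 \<and>
        three_lie_algebra s1 br1 \<and>
        three_lie_hom s1 br1 s0 br0 d \<and>
        rb_three_lie_rep w s0 br0 T0 s1 S T1 \<and>
        (\<forall>x y \<alpha>. d (S x y \<alpha>) = br0 x y (d \<alpha>)) \<and>
        T0 \<circ> d = d \<circ> T1 \<and>
        (\<forall>\<alpha> \<beta> \<gamma>. S (d \<alpha>) (d \<beta>) \<gamma> = br1 \<alpha> \<beta> \<gamma>) \<and>
        (\<forall>x \<alpha> \<beta>. S x (d \<alpha>) \<beta> = - S x (d \<beta>) \<alpha>))"

text \<open>The correspondence keeps \<open>d\<close>, \<open>T\<^sub>0\<close>, \<open>T\<^sub>1\<close> and the bracket of degree 0, takes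
  \<open>S(x, y)(\<alpha>) = l\<^sub>3(x, y, \<alpha>)\<close>, and sets \<open>[\<alpha>, \<beta>, \<gamma>] = l\<^sub>3(d \<alpha>, d \<beta>, \<gamma>)\<close> in degree 1.\<close>

definition crossed_module_of ::
  "('a, 'b) three_lie_2_data \<Rightarrow> ('a, 'b) crossed_module_data" where
  "crossed_module_of A =
     \<lparr>cm_br0 = l_000 A,
      cm_br1 = (\<lambda>\<alpha> \<beta> \<gamma>. l_001 A (two_d A \<alpha>) (two_d A \<beta>) \<gamma>),
      cm_d = two_d A,
      cm_S = l_001 A,
      cm_T0 = two_T0 A,
      cm_T1 = two_T1 A\<rparr>"

end

theory Submission imports Defs begin

text \<open>Skew-symmetry forces \<open>l\<^sub>3(x, \<alpha>, y) = - S(x, y)(\<alpha>)\<close> and \<open>l\<^sub>3(\<alpha>, x, y) = S(x, y)(\<alpha>)\<close> for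
  \<open>S(x, y)(\<alpha>) = l\<^sub>3(x, y, \<alpha>)\<close>. After this substitution axiom (2) becomes
  \<open>S(x, d \<alpha>)(\<beta>) = - S(x, d \<beta>)(\<alpha>)\<close>, and the two mixed fundamental identities in (3) become the
  two axioms of a representation. The bracket \<open>S(d \<alpha>, d \<beta>)(\<gamma>)\<close> on \<open>\<gg>\<^sub>1\<close> is skew by (2), and its
  fundamental identity is a representation axiom on the image of \<open>d\<close>, because
  \<open>d(S(d \<alpha>, d \<beta>)(\<gamma>)) = [d \<alpha>, d \<beta>, d \<gamma>]\<close>.\<close>

text \<open>Here the characteristic enters: \<open>x = - x\<close> says \<open>2 x = 0\<close>, and
  2 is invertible. The lemma leads from skew-symmetry, which the 2-algebra axioms provide, to the
  vanishing on repeated arguments that the 3-Lie axioms demand.\<close>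

lemma eq_neg_self_imp_zero:
  fixes s :: "'k::field \<Rightarrow> 'a::ab_group_add \<Rightarrow> 'a" and x :: 'a
  assumes "vector_space s" and "(2::'k) \<noteq> 0" and "x = - x"
  shows "x = 0"
proof -
  interpret vector_space s by fact
  have "s 2 x = x + x"
    by (metis one_add_one scale_left_distrib scale_one)
  also have "\<dots> = 0"
    using assms(3) by (metis add.right_inverse)
  finally show ?thesis
    using assms(2) by simp
qed

text \<open>Polarization: expand \<open>f (x + y) (x + y) = 0\<close>. This is the way back, from
  alternating crossed module data to a skew-symmetric \<open>l3\<close>.\<close>

lemma additive_alternating_imp_skew:
  fixes f :: "'a::ab_group_add \<Rightarrow> 'a \<Rightarrow> 'b::ab_group_add"
  assumes "\<And>x x' y. f (x + x') y = f x y + f x' y"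
    and "\<And>x y y'. f x (y + y') = f x y + f x y'"
    and alt: "\<And>x. f x x = 0"
  shows "f y x = - f x y"
proof -
  have "0 = f (x + y) (x + y)"
    by (simp add: alt)
  also have "\<dots> = f x y + f y x"
    unfolding assms(1,2) by (simp add: alt)
  finally show ?thesis
    by (simp add: eq_neg_iff_add_eq_0 add.commute)
qed

lemma trilinear_skew12:
  assumes "trilinear s s t u f" and "\<And>x z. f x x z = 0"
  shows "f y x z = - f x y z"
  using assms
  by (intro additive_alternating_imp_skew[where f = "\<lambda>x y. f x y z"])
     (auto simp: trilinear_def Vector_Spaces.linear_iff)

lemma trilinear_skew23:
  assumes "trilinear s t t u f" and "\<And>x y. f x y y = 0"
  shows "f x z y = - f x y z"
  using assms
  by (intro additive_alternating_imp_skew[where f = "f x"])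
     (auto simp: trilinear_def Vector_Spaces.linear_iff)

text \<open>Meant for \<open>l_010\<close> when it is rebuilt from \<open>l_001\<close>;
  \<open>trilinear_rotate\<close> does the same for \<open>l_100\<close>.\<close>

lemma trilinear_swap23_uminus:
  assumes "trilinear sa sb sc sd f"
  shows "trilinear sa sc sb sd (\<lambda>x z y. - f x y z)"
proof -
  interpret vector_space sd
    using assms by (simp add: trilinear_def Vector_Spaces.linear_iff)
  show ?thesis
    using assms by (simp add: trilinear_def Vector_Spaces.linear_iff)
qed

lemma trilinear_rotate:
  assumes "trilinear sa sb sc sd f"
  shows "trilinear sc sa sb sd (\<lambda>z x y. f x y z)"
  using assms by (auto simp: trilinear_def)

lemma trilinear_comp12:
  assumes "trilinear sa sa sc sd f" and "Vector_Spaces.linear se sa g"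
  shows "trilinear se se sc sd (\<lambda>x y z. f (g x) (g y) z)"
  using assms by (auto simp: trilinear_def Vector_Spaces.linear_iff)

text \<open>Only the alternating property takes an argument in each slot pair: the first pair
  inherits it from \<open>S\<close>, the other two get it from \<open>peiffer\<close>.\<close>

lemma three_lie_algebra_of_rep:
  fixes s0 :: "'k::field_char_0 \<Rightarrow> 'a::ab_group_add \<Rightarrow> 'a"
    and s1 :: "'k \<Rightarrow> 'b::ab_group_add \<Rightarrow> 'b"
  assumes rep: "three_lie_rep s0 br s1 S"
    and lin: "Vector_Spaces.linear s1 s0 d"
    and equiv: "\<And>x y \<alpha>. d (S x y \<alpha>) = br x y (d \<alpha>)"
    and peiffer: "\<And>x \<alpha> \<beta>. S x (d \<alpha>) \<beta> = - S x (d \<beta>) \<alpha>"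
  shows "three_lie_algebra s1 (\<lambda>\<alpha> \<beta> \<gamma>. S (d \<alpha>) (d \<beta>) \<gamma>)"
proof -
  interpret V1: vector_space s1
    using lin by (simp add: Vector_Spaces.linear_iff)
  have tri: "trilinear s0 s0 s1 s1 S" and alt: "S x x m = 0" for x m
    using rep by (auto simp: three_lie_rep_def)
  have rep1: "S x1 x2 (S x3 x4 m) = S (br x1 x2 x3) x4 m + S x3 (br x1 x2 x4) m + S x3 x4 (S x1 x2 m)"
    for x1 x2 x3 x4 m
    using rep unfolding three_lie_rep_def by blast
  \<comment> \<open>\<open>peiffer\<close> with equal arguments makes this value its own
    negative.\<close>
  have "S x (d \<alpha>) \<alpha> = 0" for x \<alpha>
    using eq_neg_self_imp_zero[OF V1.vector_space_axioms] peiffer by (metis zero_neq_numeral)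
  \<comment> \<open>\<open>peiffer\<close> exchanges the last two arguments and so brings the equal
    ones together in \<open>S\<close>, where \<open>alt\<close> applies.\<close>
  moreover have "S (d \<alpha>) (d \<beta>) \<alpha> = 0" for \<alpha> \<beta>
    using peiffer[of "d \<alpha>" \<beta> \<alpha>] by (simp add: alt)
  moreover have "trilinear s1 s1 s1 s1 (\<lambda>\<alpha> \<beta> \<gamma>. S (d \<alpha>) (d \<beta>) \<gamma>)"
    by (rule trilinear_comp12[OF tri lin])
  moreover have "S (d x1) (d x2) (S (d x3) (d x4) x5) =
      S (d (S (d x1) (d x2) x3)) (d x4) x5 + S (d x3) (d (S (d x1) (d x2) x4)) x5
      + S (d x3) (d x4) (S (d x1) (d x2) x5)" for x1 x2 x3 x4 x5
    unfolding equiv by (rule rep1)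
  ultimately show ?thesis
    unfolding three_lie_algebra_def using alt by blast
qed

text \<open>\<open>crossed_module_of\<close> forgets exactly \<open>l_010\<close> and
  \<open>l_100\<close>. The two extra equations say how \<open>l_001\<close> determines them, so
  that both injectivity and surjectivity of the correspondence can be read off from this
  equivalence.\<close>

lemma strict_rb_three_lie_2_algebra_iff:
  fixes w :: "'k::field_char_0"
    and s0 :: "'k \<Rightarrow> 'a::ab_group_add \<Rightarrow> 'a"
    and s1 :: "'k \<Rightarrow> 'b::ab_group_add \<Rightarrow> 'b"
  shows "strict_rb_three_lie_2_algebra w s0 s1 A \<longleftrightarrow>
    rb_three_lie_crossed_module w s0 s1 (crossed_module_of A) \<and>
    l_010 A = (\<lambda>x \<alpha> y. - l_001 A x y \<alpha>) \<and> l_100 A = (\<lambda>\<alpha> x y. l_001 A x y \<alpha>)"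
    (is "?L \<longleftrightarrow> ?R \<and> ?m010 \<and> ?m100")
proof -
  define d where "d = two_d A"
  define l where "l = l_000 A"
  define S where "S = l_001 A"
  define T0 where "T0 = two_T0 A"
  define T1 where "T1 = two_T1 A"
  note fields = d_def[symmetric] l_def[symmetric] S_def[symmetric] T0_def[symmetric] T1_def[symmetric]
  show ?thesis
  proof
    assume L: ?L
    note L' = L[unfolded strict_rb_three_lie_2_algebra_def Let_def fields]
    have skew: "l3_skew_symmetric A"
      using L' by blast
    then have skew_l: "l y x z = - l x y z" "l x z y = - l x y z"
      and skew_S: "S y x \<alpha> = - S x y \<alpha>" for x y z \<alpha>
      unfolding l3_skew_symmetric_def fields by blast+
    from skew have m010: "l_010 A x \<alpha> y = - S x y \<alpha>" for x \<alpha> y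
      unfolding l3_skew_symmetric_def fields by blast
    from skew have m100: "l_100 A \<alpha> x y = S x y \<alpha>" for x \<alpha> y
      unfolding l3_skew_symmetric_def fields by (metis minus_minus)
    \<comment> \<open>From here on every axiom speaks of \<open>S\<close>, \<open>l\<close>,
      \<open>d\<close>, \<open>T0\<close> and \<open>T1\<close> alone.\<close>
    note A = L'[unfolded m010 m100]
    have lin: "Vector_Spaces.linear s1 s0 d" "Vector_Spaces.linear s0 s0 T0"
      "Vector_Spaces.linear s1 s1 T1"
      and tri: "trilinear s0 s0 s0 s0 l" "trilinear s0 s0 s1 s1 S"
      and equiv: "\<And>x y \<alpha>. d (S x y \<alpha>) = l x y (d \<alpha>)"
      and comm: "T0 \<circ> d = d \<circ> T1"
      using A by meson+
    have ax2: "S (d \<beta>) x \<alpha> = - S (d \<alpha>) x \<beta>" for \<alpha> \<beta> x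
      using A by meson
    have ax3: "l a1 a2 (l a3 a4 a5) = l (l a1 a2 a3) a4 a5 + l a3 (l a1 a2 a4) a5
        + l a3 a4 (l a1 a2 a5)" for a1 a2 a3 a4 a5
      using A by meson
    \<comment> \<open>The fundamental identity with its degree 1 element in the first slot; the
      negative term is the one containing \<open>l_010\<close>.\<close>
    have ax3': "S a2 (l a3 a4 a5) \<alpha> = S a4 a5 (S a2 a3 \<alpha>) + - S a3 a5 (S a2 a4 \<alpha>)
        + S a3 a4 (S a2 a5 \<alpha>)" for \<alpha> a2 a3 a4 a5
      using A by meson
    \<comment> \<open>The same identity with the degree 1 element in the third slot. Moving it to
      the last slot gives the commutation rule of a representation, up to the order of the
      summands.\<close>
    have ax3'': "S a1 a2 (S a4 a5 \<alpha>) = S a4 a5 (S a1 a2 \<alpha>) + S (l a1 a2 a4) a5 \<alpha>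
        + S a4 (l a1 a2 a5) \<alpha>" for \<alpha> a1 a2 a4 a5
      using A by meson
    have ax5: "T0 (l (T0 x) (T0 y) z + l x (T0 y) (T0 z) + l (T0 x) y (T0 z)
        + s0 w (l (T0 x) y z) + s0 w (l x (T0 y) z) + s0 w (l x y (T0 z)) + s0 (w\<^sup>2) (l x y z))
      = l (T0 x) (T0 y) (T0 z)" for x y z
      using A by meson
    have ax6: "T1 (S (T0 x) (T0 y) \<alpha> + S x (T0 y) (T1 \<alpha>) + S (T0 x) y (T1 \<alpha>)
        + s1 w (S (T0 x) y \<alpha>) + s1 w (S x (T0 y) \<alpha>) + s1 w (S x y (T1 \<alpha>)) + s1 (w\<^sup>2) (S x y \<alpha>))
      = S (T0 x) (T0 y) (T1 \<alpha>)" for x y \<alpha>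
      using A by meson
    interpret V0: vector_space s0
      using lin by (simp add: Vector_Spaces.linear_iff)
    interpret V1: vector_space s1
      using lin by (simp add: Vector_Spaces.linear_iff)
    have alt: "l x x y = 0" "l y x x = 0" for x y
      using eq_neg_self_imp_zero[OF V0.vector_space_axioms] skew_l by (metis zero_neq_numeral)+
    \<comment> \<open>The outer pair is not adjacent; one transposition reduces it to an adjacent
      pair.\<close>
    moreover have "l x y x = 0" for x y
      using skew_l(2)[of x y x] by (simp add: alt)
    ultimately have alg: "three_lie_algebra s0 l"
      unfolding three_lie_algebra_def using tri ax3 by blast
    have "S x x \<alpha> = 0" for x \<alpha>
      using eq_neg_self_imp_zero[OF V1.vector_space_axioms] skew_S by (metis zero_neq_numeral)
    moreover have "S a1 a2 (S a3 a4 \<alpha>) = S (l a1 a2 a3) a4 \<alpha> + S a3 (l a1 a2 a4) \<alpha>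
        + S a3 a4 (S a1 a2 \<alpha>)" for a1 a2 a3 a4 \<alpha>
      by (subst ax3'') (simp only: add.commute add.left_commute add.assoc)
    moreover have "S a1 (l a2 a3 a4) \<alpha> = S a3 a4 (S a1 a2 \<alpha>) - S a2 a4 (S a1 a3 \<alpha>)
        + S a2 a3 (S a1 a4 \<alpha>)" for a1 a2 a3 a4 \<alpha>
      by (subst ax3') simp
    ultimately have rep: "three_lie_rep s0 l s1 S"
      unfolding three_lie_rep_def using tri by blast
    have peiffer: "S x (d \<alpha>) \<beta> = - S x (d \<beta>) \<alpha>" for x \<alpha> \<beta>
      using ax2[of \<beta> x \<alpha>] skew_S by metis
    have "three_lie_algebra s1 (\<lambda>\<alpha> \<beta> \<gamma>. S (d \<alpha>) (d \<beta>) \<gamma>)"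
      using rep lin(1) equiv peiffer by (rule three_lie_algebra_of_rep)
    \<comment> \<open>Compatibility with the brackets is \<open>equiv\<close> with \<open>x\<close>
      and \<open>y\<close> in the image of \<open>d\<close>.\<close>
    moreover have "three_lie_hom s1 (\<lambda>\<alpha> \<beta> \<gamma>. S (d \<alpha>) (d \<beta>) \<gamma>) s0 l d"
      unfolding three_lie_hom_def using lin equiv by simp
    \<comment> \<open>The two Rota-Baxter identities below differ from axioms (5) and (6) only in
      orientation and in the order of the summands.\<close>
    moreover have "rb_three_lie_algebra w s0 l T0"
      unfolding rb_three_lie_algebra_def using alg lin
      by (simp add: ax5[symmetric] add.commute add.left_commute)
    moreover have "rb_three_lie_rep w s0 l T0 s1 S T1"
      unfolding rb_three_lie_rep_def using rep lin
      by (simp add: ax6[symmetric] add.commute add.left_commute add.assoc)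
    ultimately have ?R
      unfolding rb_three_lie_crossed_module_def crossed_module_of_def Let_def
        crossed_module_data.select_convs fields
      by (intro conjI allI refl equiv comm peiffer)
    then show "?R \<and> ?m010 \<and> ?m100"
      by (simp add: fields m010 m100 fun_eq_iff)
  next
    assume R: "?R \<and> ?m010 \<and> ?m100"
    then have C: "rb_three_lie_algebra w s0 l T0" "three_lie_hom s1 (\<lambda>\<alpha> \<beta> \<gamma>. S (d \<alpha>) (d \<beta>) \<gamma>) s0 l d"
        "rb_three_lie_rep w s0 l T0 s1 S T1"
      and equiv: "\<And>x y \<alpha>. d (S x y \<alpha>) = l x y (d \<alpha>)" and comm: "T0 \<circ> d = d \<circ> T1"
      and peiffer: "\<And>x \<alpha> \<beta>. S x (d \<alpha>) \<beta> = - S x (d \<beta>) \<alpha>"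
      unfolding rb_three_lie_crossed_module_def crossed_module_of_def Let_def
        crossed_module_data.select_convs fields
      by meson+
    from R have m010: "l_010 A = (\<lambda>x \<alpha> y. - S x y \<alpha>)" and m100: "l_100 A = (\<lambda>\<alpha> x y. S x y \<alpha>)"
      by (simp_all add: fields)
    have alg: "three_lie_algebra s0 l" and rep: "three_lie_rep s0 l s1 S"
      and lin: "Vector_Spaces.linear s1 s0 d" "Vector_Spaces.linear s0 s0 T0"
        "Vector_Spaces.linear s1 s1 T1"
      using C unfolding rb_three_lie_algebra_def three_lie_hom_def rb_three_lie_rep_def by blast+
    have rb0: "l (T0 x) (T0 y) (T0 z) = T0 (l (T0 x) (T0 y) z + l (T0 x) y (T0 z) + l x (T0 y) (T0 z)
        + s0 w (l (T0 x) y z) + s0 w (l x (T0 y) z) + s0 w (l x y (T0 z)) + s0 (w\<^sup>2) (l x y z))" for x y z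
      using C(1) unfolding rb_three_lie_algebra_def by blast
    have rb1: "S (T0 x) (T0 y) (T1 \<alpha>) = T1 (S (T0 x) (T0 y) \<alpha> + S (T0 x) y (T1 \<alpha>) + S x (T0 y) (T1 \<alpha>)
        + s1 w (S (T0 x) y \<alpha>) + s1 w (S x (T0 y) \<alpha>) + s1 w (S x y (T1 \<alpha>)) + s1 (w\<^sup>2) (S x y \<alpha>))" for x y \<alpha>
      using C(3) unfolding rb_three_lie_rep_def by blast
    have tri: "trilinear s0 s0 s0 s0 l" "trilinear s0 s0 s1 s1 S"
      using alg rep unfolding three_lie_algebra_def three_lie_rep_def by blast+
    have jac: "l a1 a2 (l a3 a4 a5) = l (l a1 a2 a3) a4 a5 + l a3 (l a1 a2 a4) a5
        + l a3 a4 (l a1 a2 a5)" for a1 a2 a3 a4 a5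
      using alg unfolding three_lie_algebra_def by blast
    have rep1: "S a1 a2 (S a3 a4 \<alpha>) = S (l a1 a2 a3) a4 \<alpha> + S a3 (l a1 a2 a4) \<alpha> + S a3 a4 (S a1 a2 \<alpha>)"
      and rep2: "S a1 (l a2 a3 a4) \<alpha> = S a3 a4 (S a1 a2 \<alpha>) - S a2 a4 (S a1 a3 \<alpha>) + S a2 a3 (S a1 a4 \<alpha>)"
      for a1 a2 a3 a4 \<alpha>
      using rep unfolding three_lie_rep_def by blast+
    \<comment> \<open>Repeated adjacent arguments suffice, since \<open>l3_skew_symmetric\<close>
      asks only for the two adjacent transpositions.\<close>
    have "l x x y = 0" "l y x x = 0" "S x x \<alpha> = 0" for x y \<alpha>
      using alg rep unfolding three_lie_algebra_def three_lie_rep_def by blast+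
    then have skew_l: "l y x z = - l x y z" "l x z y = - l x y z" and skew_S: "S y x \<alpha> = - S x y \<alpha>"
      for x y z \<alpha>
      using trilinear_skew12[OF tri(1)] trilinear_skew23[OF tri(1)] trilinear_skew12[OF tri(2)]
      by blast+
    have skew: "l3_skew_symmetric A"
      unfolding l3_skew_symmetric_def fields m010 m100 using skew_l skew_S by (metis minus_minus)
    have ax2: "S (d \<beta>) x \<alpha> = - S (d \<alpha>) x \<beta>" for \<alpha> \<beta> x
      using peiffer[of x \<alpha> \<beta>] skew_S by metis
    have ax3': "S a2 (l a3 a4 a5) \<alpha> = S a4 a5 (S a2 a3 \<alpha>) + - S a3 a5 (S a2 a4 \<alpha>)
        + S a3 a4 (S a2 a5 \<alpha>)" for \<alpha> a2 a3 a4 a5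
      by (simp add: rep2)
    have ax3'': "S a1 a2 (S a4 a5 \<alpha>) = S a4 a5 (S a1 a2 \<alpha>) + S (l a1 a2 a4) a5 \<alpha>
        + S a4 (l a1 a2 a5) \<alpha>" for \<alpha> a1 a2 a4 a5
      by (subst rep1) (simp only: add.commute add.left_commute add.assoc)
    have ax5: "T0 (l (T0 x) (T0 y) z + l x (T0 y) (T0 z) + l (T0 x) y (T0 z)
        + s0 w (l (T0 x) y z) + s0 w (l x (T0 y) z) + s0 w (l x y (T0 z)) + s0 (w\<^sup>2) (l x y z))
      = l (T0 x) (T0 y) (T0 z)" for x y z
      by (simp add: rb0 add.commute add.left_commute add.assoc)
    have ax6: "T1 (S (T0 x) (T0 y) \<alpha> + S x (T0 y) (T1 \<alpha>) + S (T0 x) y (T1 \<alpha>)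
        + s1 w (S (T0 x) y \<alpha>) + s1 w (S x (T0 y) \<alpha>) + s1 w (S x y (T1 \<alpha>)) + s1 (w\<^sup>2) (S x y \<alpha>))
      = S (T0 x) (T0 y) (T1 \<alpha>)" for x y \<alpha>
      by (simp add: rb1 add.commute add.left_commute add.assoc)
    show ?L
      unfolding strict_rb_three_lie_2_algebra_def Let_def fields m010 m100
      by (intro conjI allI lin tri skew equiv comm ax2 jac ax3' ax3'' ax5 ax6
          trilinear_swap23_uminus[OF tri(2)] trilinear_rotate[OF tri(2)])
  qed
qed

theorem theorem6p5:
  fixes w :: "'k::field_char_0"
    and s0 :: "'k \<Rightarrow> 'a::ab_group_add \<Rightarrow> 'a"
    and s1 :: "'k \<Rightarrow> 'b::ab_group_add \<Rightarrow> 'b"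
  assumes "vector_space s0" and "vector_space s1"
  shows "bij_betw crossed_module_of
           {A. strict_rb_three_lie_2_algebra w s0 s1 A}
           {C. rb_three_lie_crossed_module w s0 s1 C}"
  unfolding bij_betw_def
proof
  show "inj_on crossed_module_of {A. strict_rb_three_lie_2_algebra w s0 s1 A}"
  proof (rule inj_onI)
    fix A B
    assume "A \<in> {A. strict_rb_three_lie_2_algebra w s0 s1 A}"
      and "B \<in> {A. strict_rb_three_lie_2_algebra w s0 s1 A}"
    \<comment> \<open>The fields lost in the crossed module are functions of \<open>l_001\<close>,
      which survives as \<open>cm_S\<close>.\<close>
    then have "l_010 A = (\<lambda>x \<alpha> y. - l_001 A x y \<alpha>)" "l_100 A = (\<lambda>\<alpha> x y. l_001 A x y \<alpha>)"
      and "l_010 B = (\<lambda>x \<alpha> y. - l_001 B x y \<alpha>)" "l_100 B = (\<lambda>\<alpha> x y. l_001 B x y \<alpha>)"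
      unfolding strict_rb_three_lie_2_algebra_iff by blast+
    moreover assume "crossed_module_of A = crossed_module_of B"
    then have "two_d A = two_d B" "l_000 A = l_000 B" "l_001 A = l_001 B"
      "two_T0 A = two_T0 B" "two_T1 A = two_T1 B"
      by (simp_all add: crossed_module_of_def)
    ultimately show "A = B"
      by (intro three_lie_2_data.equality) simp_all
  qed
next
  show "crossed_module_of ` {A. strict_rb_three_lie_2_algebra w s0 s1 A}
      = {C. rb_three_lie_crossed_module w s0 s1 C}"
  proof (intro equalityI subsetI)
    fix C assume "C \<in> crossed_module_of ` {A. strict_rb_three_lie_2_algebra w s0 s1 A}"
    then show "C \<in> {C. rb_three_lie_crossed_module w s0 s1 C}"
      unfolding strict_rb_three_lie_2_algebra_iff by blast
  next
    fix C assume "C \<in> {C. rb_three_lie_crossed_module w s0 s1 C}"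
    then have C: "rb_three_lie_crossed_module w s0 s1 C" by simp
    \<comment> \<open>This choice is forced: \<open>cm_S\<close> must be \<open>l_001\<close>, and
      skew-symmetry fixes the signs of the other two mixed maps.\<close>
    define A where "A = \<lparr>two_d = cm_d C, l_000 = cm_br0 C, l_001 = cm_S C,
      l_010 = (\<lambda>x \<alpha> y. - cm_S C x y \<alpha>), l_100 = (\<lambda>\<alpha> x y. cm_S C x y \<alpha>),
      two_T0 = cm_T0 C, two_T1 = cm_T1 C\<rparr>"
    \<comment> \<open>\<open>A\<close> does not store the bracket of degree 1; the axiom expressing
      it through \<open>S\<close> and \<open>d\<close> recovers it.\<close>
    have "(\<lambda>\<alpha> \<beta> \<gamma>. cm_S C (cm_d C \<alpha>) (cm_d C \<beta>) \<gamma>) = cm_br1 C"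
      using C unfolding rb_three_lie_crossed_module_def Let_def by blast
    then have "crossed_module_of A = C"
      by (simp add: crossed_module_of_def A_def)
    moreover have "strict_rb_three_lie_2_algebra w s0 s1 A"
      unfolding strict_rb_three_lie_2_algebra_iff \<open>crossed_module_of A = C\<close>
      using C by (simp add: A_def)
    ultimately show "C \<in> crossed_module_of ` {A. strict_rb_three_lie_2_algebra w s0 s1 A}"
      by blast
  qed
qed

end
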